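(* Let $p$ be a prime, $e\geq 0$ an integer, and let $G$ and $H$ be finite abelian $p$-groups of exponent $\le p^e$. With $r_k$, $\tilde r_k$, $\alpha_p$ and $\delta_G$ as defined in the context, the following hold for all integers $n$: (a) $\displaystyle \delta_G(n)=-\alpha_p(G)+\sum_{k=1}^e\tilde r_k(G)\left\{\frac{n-1}{p^k}\right\}$ and $\delta_{G\times H}(n)=\delta_G(n)+\delta_H(n)$. (b) $\displaystyle \alpha_p(G)=\sum_{k=1}^e\tilde r_k(G)\,\frac{p^k-1}{p^k}$ and $\alpha_p(G\times H)=\alpha_p(G)+\alpha_p(H)$. (c) $\delta_G(1)=-\alpha_p(G)\le\delta_G(n)\le 0=\delta_G(0)$.
   Context: For a finite abelian $p$-group $G$ (written multiplicatively) and $k\ge1$: $r_k(G):=\dim_{\mathbb{F}_p}\left(G^{p^{k-1}}/G^{p^k}\right)$ and $\tilde r_k(G):=r_k(G)-r_{k+1}(G)$. For integers $a$ and $b\ge1$ write $\left\{\frac ab\right\}:=\frac ab-\left\lfloor\frac ab\right\rfloor$. For $m\in\mathbb{Z}$ and $k\ge1$: $$\delta(m,k):=\left\{\frac{m}{p^k}\right\}-\left\{\frac{m}{p^{k-1}}\right\}.$$ For $G$ of exponent dividing $p^e$ and $n\in\mathbb{Z}$: $$\alpha_p(G):=\sum_{k=1}^e\frac{p-1}{p^k}r_k(G),\qquad\delta_G(n):=-\alpha_p(G)+\sum_{k=1}^e r_k(G)\,\delta(n-1,k).$$ (These do not depend on the choice of $e$ with $\exp(G)\mid p^e$, since $r_k(G)=0$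 for $p^k>\exp(G)$.) *)

theory Defs
  imports
    "Jordan_Normal_Form.Missing_VectorSpace"
    "HOL-Number_Theory.Residues"
    Complex_Main
begin

definition finite_abelian_p_group :: "nat \<Rightarrow> ('a, 'm) monoid_scheme \<Rightarrow> bool" where
  "finite_abelian_p_group p G \<longleftrightarrow>
     comm_group G \<and> finite (carrier G) \<and> (\<exists>m. order G = p ^ m)"

definition group_exponent :: "('a, 'm) monoid_scheme \<Rightarrow> nat" where
  "group_exponent G = (LEAST n. 0 < n \<and> (\<forall>x\<in>carrier G. x [^]\<^bsub>G\<^esub> n = \<one>\<^bsub>G\<^esub>))"

definition power_subgroup :: "('a, 'm) monoid_scheme \<Rightarrow> nat \<Rightarrow> 'a set" where
  "power_subgroup G n = (\<lambda>x. x [^]\<^bsub>G\<^esub> n) ` carrier G"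

definition power_quotient :: "nat \<Rightarrow> nat \<Rightarrow> ('a, 'm) monoid_scheme \<Rightarrow> 'a set monoid" where
  "power_quotient p k G =
     (G\<lparr>carrier := power_subgroup G (p ^ (k - 1))\<rparr>) Mod (power_subgroup G (p ^ k))"

text \<open>An abelian group killed by \<^term>\<open>p :: nat\<close>, written multiplicatively, as a vector
  space over the prime field \<^term>\<open>residue_ring (int p)\<close> with scalar multiplication
  given by powers. The record field \<open>mult\<close> plays no role in a module.\<close>

definition Fp_space :: "nat \<Rightarrow> ('a, 'm) monoid_scheme \<Rightarrow> (int, 'a) module" where
  "Fp_space p Q =
     \<lparr>carrier = carrier Q, monoid.mult = undefined, one = undefined,
      zero = \<one>\<^bsub>Q\<^esub>, add = monoid.mult Q, smult = (\<lambda>a x. x [^]\<^bsub>Q\<^esub> a)\<rparr>"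

definition rk :: "nat \<Rightarrow> nat \<Rightarrow> ('a, 'm) monoid_scheme \<Rightarrow> nat" where
  "rk p k G = vectorspace.dim (residue_ring (int p)) (Fp_space p (power_quotient p k G))"

definition rk_tilde :: "nat \<Rightarrow> nat \<Rightarrow> ('a, 'm) monoid_scheme \<Rightarrow> int" where
  "rk_tilde p k G = int (rk p k G) - int (rk p (k + 1) G)"

definition delta_frac :: "nat \<Rightarrow> int \<Rightarrow> nat \<Rightarrow> real" where
  "delta_frac p m k = frac (of_int m / real p ^ k) - frac (of_int m / real p ^ (k - 1))"

text \<open>The parameter \<open>e\<close> is any number such that the exponent of the group divides \<open>p ^ e\<close>; the
  values do not depend on it, see \<open>alpha_indep\<close> and \<open>delta_indep\<close> below.\<close>

definition alpha :: "nat \<Rightarrow> nat \<Rightarrow> ('a, 'm) monoid_scheme \<Rightarrow> real" where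
  "alpha p e G = (\<Sum>k=1..e. (real p - 1) / real p ^ k * real (rk p k G))"

definition delta :: "nat \<Rightarrow> nat \<Rightarrow> ('a, 'm) monoid_scheme \<Rightarrow> int \<Rightarrow> real" where
  "delta p e G n = - alpha p e G + (\<Sum>k=1..e. real (rk p k G) * delta_frac p (n - 1) k)"

lemma vectorspace_Fp_space:
  fixes Q (structure)
  assumes p: "prime p" and Q: "comm_group Q"
    and pow: "\<And>x. x \<in> carrier Q \<Longrightarrow> x [^] p = \<one>"
  shows "vectorspace (residue_ring (int p)) (Fp_space p Q)"
proof -
  interpret Q: comm_group Q by fact
  interpret R: residues_prime p "residue_ring (int p)"
    using p by unfold_locales auto
  have F: "field (residue_ring (int p))" by (rule R.is_field)
  have red: "x [^] (a mod int p) = x [^] a" if x: "x \<in> carrier Q" for x and a :: int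
  proof -
    have "x [^] a = x [^] (int p * (a div int p) + a mod int p)" by simp
    also have "\<dots> = (x [^] int p) [^] (a div int p) \<otimes> x [^] (a mod int p)"
      using x by (simp only: Q.int_pow_mult Q.int_pow_pow)
    also have "x [^] int p = \<one>" using pow[OF x] by (simp add: int_pow_int)
    finally show ?thesis using x by simp
  qed
  have ab: "abelian_group (Fp_space p Q)"
    by (rule abelian_groupI) (auto simp: Fp_space_def Q.m_ac intro: Q.l_inv_ex)
  have "Module.module (residue_ring (int p)) (Fp_space p Q)"
  proof (rule Module.moduleI)
    show "cring (residue_ring (int p))" by (rule R.cring)
    show "abelian_group (Fp_space p Q)" by (rule ab)
    have "x [^] (a * b) = (x [^] b) [^] a" if "x \<in> carrier Q" for x and a b :: int
      using that by (simp add: Q.int_pow_pow mult.commute)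
    then show "(a \<otimes>\<^bsub>residue_ring (int p)\<^esub> b) \<odot>\<^bsub>Fp_space p Q\<^esub> x
        = a \<odot>\<^bsub>Fp_space p Q\<^esub> (b \<odot>\<^bsub>Fp_space p Q\<^esub> x)"
      if "x \<in> carrier (Fp_space p Q)" for a b x
      using that by (simp add: Fp_space_def residue_ring_def red)
  qed (auto simp: Fp_space_def residue_ring_def red Q.int_pow_mult Q.int_pow_distrib)
  with F show ?thesis by (simp add: vectorspace_def)
qed

lemma subgroup_power:
  assumes "comm_group G" shows "subgroup (power_subgroup G n) G"
proof -
  interpret comm_group G by fact
  show ?thesis
  proof
    show "power_subgroup G n \<subseteq> carrier G" by (auto simp: power_subgroup_def)
    show "\<one>\<^bsub>G\<^esub> \<in> power_subgroup G n"
      by (auto simp: power_subgroup_def intro!: image_eqI[of _ _ "\<one>\<^bsub>G\<^esub>"])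
    show "x \<otimes>\<^bsub>G\<^esub> y \<in> power_subgroup G n"
      if "x \<in> power_subgroup G n" "y \<in> power_subgroup G n" for x y
      using that by (auto simp: power_subgroup_def simp flip: nat_pow_distrib)
    show "inv\<^bsub>G\<^esub> x \<in> power_subgroup G n" if "x \<in> power_subgroup G n" for x
      using that by (auto simp: power_subgroup_def nat_pow_inv intro!: image_eqI[of _ _ "inv\<^bsub>G\<^esub> _"])
  qed
qed

lemma comm_group_power: "comm_group G \<Longrightarrow> comm_group (G\<lparr>carrier := power_subgroup G n\<rparr>)"
proof (rule group.group_comm_groupI)
  assume G: "comm_group G"
  then interpret comm_group G .
  interpret K: subgroup "power_subgroup G n" G using G by (rule subgroup_power)
  show "group (G\<lparr>carrier := power_subgroup G n\<rparr>)" by (rule K.subgroup_is_group) (rule is_group)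
  show "x \<otimes>\<^bsub>G\<lparr>carrier := power_subgroup G n\<rparr>\<^esub> y = y \<otimes>\<^bsub>G\<lparr>carrier := power_subgroup G n\<rparr>\<^esub> x"
    if "x \<in> carrier (G\<lparr>carrier := power_subgroup G n\<rparr>)"
       "y \<in> carrier (G\<lparr>carrier := power_subgroup G n\<rparr>)" for x y
    using that K.subset by (auto simp: m_comm)
qed

lemma power_subgroup_Suc:
  assumes "comm_group G" and "0 < k"
  shows "power_subgroup G (p ^ k) = (\<lambda>x. x [^]\<^bsub>G\<^esub> p) ` power_subgroup G (p ^ (k - 1))"
proof -
  interpret comm_group G by fact
  have "p ^ k = p ^ (k - 1) * p" using assms(2) by (cases k) auto
  then show ?thesis by (force simp: power_subgroup_def image_image nat_pow_pow)
qed

lemma subgroup_power_Suc: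
  assumes "comm_group G" and "0 < k"
  shows "subgroup (power_subgroup G (p ^ k)) (G\<lparr>carrier := power_subgroup G (p ^ (k - 1))\<rparr>)"
proof -
  interpret comm_group G by fact
  interpret K: subgroup "power_subgroup G (p ^ (k - 1))" G by (rule subgroup_power) fact
  have "(y [^]\<^bsub>G\<^esub> p ^ (k - 1)) [^]\<^bsub>G\<^esub> p = (y [^]\<^bsub>G\<^esub> p) [^]\<^bsub>G\<^esub> p ^ (k - 1)"
    if "y \<in> carrier G" for y
    using that by (simp add: nat_pow_pow mult.commute)
  then have "x [^]\<^bsub>G\<^esub> p \<in> power_subgroup G (p ^ (k - 1))"
    if "x \<in> power_subgroup G (p ^ (k - 1))" for x
    using that by (auto simp: power_subgroup_def)
  then have "power_subgroup G (p ^ k) \<subseteq> power_subgroup G (p ^ (k - 1))"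
    by (auto simp: power_subgroup_Suc[OF assms])
  then show ?thesis
    using subgroup_power[OF assms(1)] by (intro subgroup_incl) auto
qed

lemma vectorspace_power_quotient:
  assumes p: "prime p" and G: "comm_group G" and k: "0 < k"
  shows "vectorspace (residue_ring (int p)) (Fp_space p (power_quotient p k G))"
proof (rule vectorspace_Fp_space[OF p])
  let ?A = "G\<lparr>carrier := power_subgroup G (p ^ (k - 1))\<rparr>" and ?N = "power_subgroup G (p ^ k)"
  interpret G: comm_group G by fact
  interpret A: comm_group ?A by (rule comm_group_power) fact
  have sub: "subgroup ?N ?A" by (rule subgroup_power_Suc) fact+
  then interpret N: normal ?N ?A by (rule A.subgroup_imp_normal)
  show "comm_group (power_quotient p k G)"
    unfolding power_quotient_def by (rule A.abelian_FactGroup) fact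
  fix X assume "X \<in> carrier (power_quotient p k G)"
  then obtain x where x: "x \<in> carrier ?A" "X = ?N #>\<^bsub>?A\<^esub> x"
    by (auto simp: power_quotient_def carrier_FactGroup)
  have "x [^]\<^bsub>?A\<^esub> p \<in> ?N"
    using x power_subgroup_Suc[OF G k] by (auto simp flip: G.nat_pow_consistent)
  then show "X [^]\<^bsub>power_quotient p k G\<^esub> p = \<one>\<^bsub>power_quotient p k G\<^esub>"
    using x A.coset_join2[OF _ sub, of "x [^]\<^bsub>?A\<^esub> p"] A.nat_pow_closed[of x p]
      N.FactGroup_pow[of x p] by (simp add: power_quotient_def del: A.nat_pow_closed)
qed

lemma group_exponent_pow:
  assumes G: "group G" "finite (carrier G)"
  shows "0 < group_exponent G"
    and "x \<in> carrier G \<Longrightarrow> x [^]\<^bsub>G\<^esub> group_exponent G = \<one>\<^bsub>G\<^esub>"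
proof -
  interpret group G by fact
  have "0 < order G \<and> (\<forall>x\<in>carrier G. x [^]\<^bsub>G\<^esub> order G = \<one>\<^bsub>G\<^esub>)"
    using G(2) by (auto simp: order_gt_0_iff_finite pow_order_eq_1)
  then have "0 < group_exponent G \<and> (\<forall>x\<in>carrier G. x [^]\<^bsub>G\<^esub> group_exponent G = \<one>\<^bsub>G\<^esub>)"
    unfolding group_exponent_def by (rule LeastI)
  then show "0 < group_exponent G"
    and "x \<in> carrier G \<Longrightarrow> x [^]\<^bsub>G\<^esub> group_exponent G = \<one>\<^bsub>G\<^esub>" by auto
qed

lemma pow_eq_one_iff_group_exponent_dvd:
  assumes G: "group G" "finite (carrier G)"
  shows "(\<forall>x\<in>carrier G. x [^]\<^bsub>G\<^esub> n = \<one>\<^bsub>G\<^esub>) \<longleftrightarrow> group_exponent G dvd n"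
proof
  interpret group G by fact
  note E = group_exponent_pow[OF G]
  show "\<forall>x\<in>carrier G. x [^]\<^bsub>G\<^esub> n = \<one>\<^bsub>G\<^esub>" if "group_exponent G dvd n"
    using that E by (auto simp flip: nat_pow_pow)
  assume n: "\<forall>x\<in>carrier G. x [^]\<^bsub>G\<^esub> n = \<one>\<^bsub>G\<^esub>"
  let ?r = "n mod group_exponent G"
  have "x [^]\<^bsub>G\<^esub> ?r = \<one>\<^bsub>G\<^esub>" if x: "x \<in> carrier G" for x
  proof -
    have "x [^]\<^bsub>G\<^esub> n = x [^]\<^bsub>G\<^esub> (group_exponent G * (n div group_exponent G) + ?r)" by simp
    also have "\<dots> = x [^]\<^bsub>G\<^esub> ?r"
      using x E(2)[OF x] by (simp only: nat_pow_mult[symmetric] nat_pow_pow[symmetric]) simp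
    finally show ?thesis using n x by simp
  qed
  then have "?r = 0"
    using E(1) not_less_Least[of ?r "\<lambda>n. 0 < n \<and> (\<forall>x\<in>carrier G. x [^]\<^bsub>G\<^esub> n = \<one>\<^bsub>G\<^esub>)"]
    by (auto simp flip: group_exponent_def)
  then show "group_exponent G dvd n" by auto
qed

lemma group_exponent_dvd:
  assumes p: "prime p" and G: "finite_abelian_p_group p G" and e: "group_exponent G \<le> p ^ e"
  shows "group_exponent G dvd p ^ e"
proof -
  obtain m where m: "order G = p ^ m" and G': "comm_group G" "finite (carrier G)"
    using G by (auto simp: finite_abelian_p_group_def)
  interpret comm_group G by fact
  have "group_exponent G dvd p ^ m"
    using pow_eq_one_iff_group_exponent_dvd[OF is_group G'(2), of "order G"]
      pow_order_eq_1 m by simp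
  then obtain i where i: "group_exponent G = p ^ i"
    using p by (auto simp: divides_primepow_nat)
  with e p have "i \<le> e" by (simp add: prime_gt_Suc_0_nat)
  with i show ?thesis by (simp add: le_imp_power_dvd)
qed

lemma rk_eq_0:
  assumes p: "prime p" and G: "finite_abelian_p_group p G"
    and e: "group_exponent G \<le> p ^ e" "e < k"
  shows "rk p k G = 0"
proof -
  have G': "comm_group G" "finite (carrier G)" using G by (auto simp: finite_abelian_p_group_def)
  interpret comm_group G by fact
  have triv: "power_subgroup G (p ^ i) = {\<one>\<^bsub>G\<^esub>}" if "e \<le> i" for i
  proof -
    have "group_exponent G dvd p ^ i"
      using group_exponent_dvd[OF p G e(1)] that by (meson dvd_trans le_imp_power_dvd)
    then have "\<forall>x\<in>carrier G. x [^]\<^bsub>G\<^esub> (p ^ i) = \<one>\<^bsub>G\<^esub>"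
      using pow_eq_one_iff_group_exponent_dvd is_group G'(2) by blast
    then show ?thesis unfolding power_subgroup_def by (auto intro!: image_eqI[of _ _ "\<one>\<^bsub>G\<^esub>"])
  qed
  let ?V = "Fp_space p (power_quotient p k G)"
  interpret V: vectorspace "residue_ring (int p)" ?V
    using vectorspace_power_quotient[OF p G'(1)] e(2) by simp
  have "carrier ?V = {\<zero>\<^bsub>?V\<^esub>}"
    using e(2) by (simp add: Fp_space_def power_quotient_def triv FactGroup_def RCOSETS_def r_coset_def)
  then have "V.gen_set {}" by (simp add: V.span_empty)
  then have "V.dim \<le> 0" unfolding V.dim_def
    by (intro Least_le exI[of _ "{}"]) auto
  then show ?thesis by (simp add: rk_def)
qed

lemma alpha_indep:
  assumes "prime p" "finite_abelian_p_group p G" "group_exponent G \<le> p ^ e" "e \<le> f"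
  shows "alpha p f G = alpha p e G"
  unfolding alpha_def using assms by (intro sum.mono_neutral_right) (auto simp: rk_eq_0)

lemma delta_indep:
  assumes "prime p" "finite_abelian_p_group p G" "group_exponent G \<le> p ^ e" "e \<le> f"
  shows "delta p f G n = delta p e G n"
proof -
  have "(\<Sum>k=1..f. real (rk p k G) * delta_frac p (n - 1) k)
      = (\<Sum>k=1..e. real (rk p k G) * delta_frac p (n - 1) k)"
    using assms by (intro sum.mono_neutral_right) (auto simp: rk_eq_0)
  then show ?thesis by (simp add: delta_def alpha_indep[OF assms])
qed

end

theory Submission
  imports Defs
begin

text \<open>Counting elements, \<^term>\<open>p ^ rk p k G\<close> is the index of the \<^term>\<open>p ^ k\<close>-th powers in the
  \<^term>\<open>p ^ (k - 1)\<close>-th powers. Raising to the \<^term>\<open>p\<close>-th power maps the larger of these two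
  groups onto the smaller one, so the index is also the number of \<^term>\<open>p\<close>-torsion elements of the
  larger one. In this form it is evident that the ranks decrease with \<^term>\<open>k\<close> and add up in direct
  products. The two formulas follow by summation by parts, and the inequalities because
  \<^term>\<open>frac (of_int m / real p ^ k)\<close> lies between \<open>0\<close> and its value at \<open>m = -1\<close>.\<close>

text \<open>A finite carrier generates itself, so a finite basis exists, and coordinates in it are
  unique. Taking coefficients in \<open>PiE\<close> fixes them off the basis, so
  \<open>lincomb\<close> becomes a bijection.\<close>

lemma (in vectorspace) card_carrier_eq_power_dim:
  assumes "finite (carrier V)"
  shows "card (carrier V) = card (carrier K) ^ dim"
proof -
  have "span (carrier V) = carrier V"
    using in_own_span[of "carrier V"] span_is_subset2[of "carrier V"] by (simp add: subset_antisym)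
  then have "fin_dim"
    unfolding fin_dim_def using assms by (intro exI[of _ "carrier V"]) simp
  then obtain A where A: "finite A" "basis A"
    using finite_basis_exists by blast
  have sub: "A \<subseteq> carrier V"
    using A(2) by (simp add: basis_def)
  have ex1: "\<exists>!a. a \<in> A \<rightarrow>\<^sub>E carrier K \<and> lincomb a A = v" if "v \<in> carrier V" for v
    using basis_criterion[OF A(1) sub] A(2) that by blast
  have closed: "lincomb a A \<in> carrier V" if "a \<in> A \<rightarrow>\<^sub>E carrier K" for a
    using that sub A(1) by (intro lincomb_closed) (auto simp: PiE_def)
  have "bij_betw (\<lambda>a. lincomb a A) (A \<rightarrow>\<^sub>E carrier K) (carrier V)"
    unfolding bij_betw_def inj_on_def
  proof (intro conjI ballI impI equalityI subsetI)
    fix a b assume "a \<in> A \<rightarrow>\<^sub>E carrier K" "b \<in> A \<rightarrow>\<^sub>E carrier K" "lincomb a A = lincomb b A"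
    then show "a = b" using ex1[OF closed] by metis
  next
    fix v assume "v \<in> carrier V"
    then show "v \<in> (\<lambda>a. lincomb a A) ` (A \<rightarrow>\<^sub>E carrier K)" using ex1 by blast
  qed (use closed in auto)
  then have "card (carrier V) = card (A \<rightarrow>\<^sub>E carrier K)"
    by (simp add: bij_betw_same_card)
  also have "\<dots> = card (carrier K) ^ dim"
    using A by (simp add: card_PiE dim_basis)
  finally show ?thesis .
qed

text \<open>First isomorphism theorem combined with Lagrange.\<close>

lemma (in group_hom) order_eq_card_kernel_mult:
  assumes "h ` carrier G = carrier H"
  shows "order G = card (kernel G H h) * order H"
proof -
  have "order (G Mod kernel G H h) = order H"
    using FactGroup_iso_set[OF assms] by (meson is_isoI iso_same_order)
  then show ?thesis
    using G.lagrange[OF subgroup_kernel] by (simp add: order_def FactGroup_def mult.commute)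
qed

text \<open>For \<open>0 < k\<close> this is the kernel of the \<open>p\<close>-th power map on the
  \<open>p ^ (k - 1)\<close>-th powers. Unlike the quotient it lies inside \<open>G\<close>, so
  different \<open>k\<close> can be compared by inclusion.\<close>

definition power_torsion :: "nat \<Rightarrow> nat \<Rightarrow> ('a, 'm) monoid_scheme \<Rightarrow> 'a set" where
  "power_torsion p k G = {x \<in> power_subgroup G (p ^ (k - 1)). x [^]\<^bsub>G\<^esub> p = \<one>\<^bsub>G\<^esub>}"

text \<open>Times \<open>order ?B\<close>, each side gives \<open>order ?A\<close>: the left by
  Lagrange, the right because the \<open>p\<close>-th power map from \<open>?A\<close> to
  \<open>?B\<close> is onto.\<close>

lemma card_power_quotient:
  assumes G: "comm_group G" "finite (carrier G)" and k: "0 < k"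
  shows "card (carrier (power_quotient p k G)) = card (power_torsion p k G)"
proof -
  let ?N = "power_subgroup G (p ^ k)"
  let ?A = "G\<lparr>carrier := power_subgroup G (p ^ (k - 1))\<rparr>" and ?B = "G\<lparr>carrier := ?N\<rparr>"
  interpret G: comm_group G by fact
  interpret A: comm_group ?A by (rule comm_group_power) fact
  interpret B: comm_group ?B by (rule comm_group_power) fact
  have sub: "power_subgroup G n \<subseteq> carrier G" for n
    by (rule subgroup.subset[OF subgroup_power]) fact
  have onto: "(\<lambda>x. x [^]\<^bsub>G\<^esub> p) ` carrier ?A = carrier ?B"
    using power_subgroup_Suc[OF G(1) k] by simp
  then have "(\<lambda>x. x [^]\<^bsub>G\<^esub> p) \<in> hom ?A ?B"
    using sub[of "p ^ (k - 1)"] by (auto simp: hom_def intro!: G.nat_pow_distrib)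
  then interpret h: group_hom ?A ?B "\<lambda>x. x [^]\<^bsub>G\<^esub> p"
    by unfold_locales
  have "order ?A = card (power_torsion p k G) * order ?B"
    using h.order_eq_card_kernel_mult[OF onto] by (simp add: kernel_def power_torsion_def)
  moreover have "order ?A = card (carrier (power_quotient p k G)) * order ?B"
    using A.lagrange[OF subgroup_power_Suc[OF G(1) k]]
    by (simp add: power_quotient_def FactGroup_def order_def)
  moreover have "0 < order ?B"
    using B.order_gt_0_iff_finite finite_subset[OF sub G(2)] by simp
  ultimately show ?thesis by simp
qed

text \<open>Turns statements about dimensions into counting; ranks are then compared as exponents of
  \<open>p > 1\<close>.\<close>

lemma prime_power_rk:
  assumes p: "prime p" and G: "comm_group G" "finite (carrier G)" and k: "0 < k"
  shows "p ^ rk p k G = card (power_torsion p k G)"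
proof -
  let ?V = "Fp_space p (power_quotient p k G)"
  interpret V: vectorspace "residue_ring (int p)" ?V
    by (rule vectorspace_power_quotient[OF p G(1) k])
  have "finite (power_subgroup G n)" for n
    using G(2) by (simp add: power_subgroup_def)
  then have "finite (carrier (power_quotient p k G))"
    by (auto simp: power_quotient_def FactGroup_def RCOSETS_def)
  then have "card (carrier (power_quotient p k G)) = p ^ rk p k G"
    using V.card_carrier_eq_power_dim by (simp add: Fp_space_def rk_def residue_ring_def)
  then show ?thesis by (simp add: card_power_quotient[OF G k])
qed

lemma rk_decreasing:
  assumes p: "prime p" and G: "comm_group G" "finite (carrier G)" and k: "0 < k"
  shows "rk p (k + 1) G \<le> rk p k G"
proof -
  have "power_subgroup G (p ^ k) \<subseteq> power_subgroup G (p ^ (k - 1))"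
    using subgroup.subset[OF subgroup_power_Suc[OF G(1) k]] by simp
  then have "power_torsion p (k + 1) G \<subseteq> power_torsion p k G"
    by (auto simp: power_torsion_def)
  moreover have "finite (power_torsion p k G)"
    using G(2) by (simp add: power_torsion_def power_subgroup_def)
  ultimately have "p ^ rk p (k + 1) G \<le> p ^ rk p k G"
    using prime_power_rk[OF p G] k by (simp add: card_mono)
  then show ?thesis using prime_gt_1_nat[OF p] by simp
qed

lemma nat_pow_DirProd:
  "(x, y) [^]\<^bsub>G \<times>\<times> H\<^esub> (n :: nat) = (x [^]\<^bsub>G\<^esub> n, y [^]\<^bsub>H\<^esub> n)"
  by (induction n) (auto simp: nat_pow_def)

lemma comm_group_DirProd:
  assumes "comm_group G" "comm_group H"
  shows "comm_group (G \<times>\<times> H)"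
proof -
  interpret G: comm_group G by fact
  interpret H: comm_group H by fact
  show ?thesis
    by (rule group.group_comm_groupI[OF DirProd_group])
      (auto simp: G.m_comm H.m_comm G.is_group H.is_group)
qed

lemma power_torsion_DirProd:
  "power_torsion p k (G \<times>\<times> H) = power_torsion p k G \<times> power_torsion p k H"
  by (force simp: power_torsion_def power_subgroup_def nat_pow_DirProd)

text \<open>Torsion is computed componentwise, so cardinalities multiply and exponents add.\<close>

lemma rk_DirProd:
  assumes p: "prime p" and G: "comm_group G" "finite (carrier G)"
    and H: "comm_group H" "finite (carrier H)" and k: "0 < k"
  shows "rk p k (G \<times>\<times> H) = rk p k G + rk p k H"
proof -
  have "p ^ rk p k (G \<times>\<times> H) = p ^ (rk p k G + rk p k H)"
    using prime_power_rk[OF p _ _ k, of "G \<times>\<times> H"] prime_power_rk[OF p G k]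
      prime_power_rk[OF p H k] comm_group_DirProd[OF G(1) H(1)] G(2) H(2)
    by (simp add: power_torsion_DirProd card_cartesian_product power_add)
  then show ?thesis using prime_gt_1_nat[OF p] by (simp only: power_inject_exp)
qed

text \<open>Both boundary terms are kept so that the induction on \<open>e\<close> goes through; at
  \<open>e = 0\<close> they cancel.\<close>

lemma sum_by_parts:
  fixes r f :: "nat \<Rightarrow> real"
  shows "(\<Sum>k=1..e. r k * (f k - f (k - 1)))
    = (\<Sum>k=1..e. (r k - r (k + 1)) * f k) + r (e + 1) * f e - r 1 * f 0"
  by (induction e) (auto simp: algebra_simps)

text \<open>The boundary terms vanish: the rank at \<open>e + 1\<close> is zero by the exponent
  bound, and \<open>f 0 = 0\<close>.\<close>

lemma sum_rk_by_parts:
  fixes f :: "nat \<Rightarrow> real"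
  assumes "prime p" "finite_abelian_p_group p G" "group_exponent G \<le> p ^ e" "f 0 = 0"
  shows "(\<Sum>k=1..e. real (rk p k G) * (f k - f (k - 1)))
    = (\<Sum>k=1..e. of_int (rk_tilde p k G) * f k)"
  using sum_by_parts[of "\<lambda>k. real (rk p k G)" f e] rk_eq_0[OF assms(1-3), of "e + 1"] assms(4)
  by (simp add: rk_tilde_def)

lemma frac_minus_one_divide:
  assumes "1 \<le> (q :: real)"
  shows "frac (- 1 / q) = (q - 1) / q"
  using assms by (subst frac_unique_iff) (auto simp: field_simps intro: Ints_minus)

text \<open>The fractional part is the remainder of \<open>m\<close> divided by \<open>q\<close>,
  and an integer remainder below \<open>q\<close> is at most \<open>q - 1\<close>.\<close>

lemma frac_of_int_divide_le:
  assumes "0 < (q :: nat)"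
  shows "frac (of_int m / real q) \<le> (real q - 1) / real q"
proof -
  have "real_of_int m = of_int (int q * (m div int q) + m mod int q)"
    by simp
  then have "of_int m / real q = of_int (m div int q) + of_int (m mod int q) / real q"
    unfolding of_int_add of_int_mult using assms by (simp add: field_simps)
  moreover have "\<lfloor>of_int m / real q\<rfloor> = m div int q"
    using floor_divide_of_int_eq[of m "int q", where ?'a = real] by simp
  ultimately have "frac (of_int m / real q) = of_int (m mod int q) / real q"
    by (simp add: frac_def)
  moreover have "m mod int q < int q"
    using assms by simp
  then have "of_int (m mod int q) \<le> real q - 1"
    by linarith
  ultimately show ?thesis
    by (simp add: divide_right_mono)
qed

theorem mainTheorem4:
  fixes p e :: nat
    and G :: "('a, 'm) monoid_scheme"
    and H :: "('b, 'n) monoid_scheme"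
  assumes "prime p"
    and "finite_abelian_p_group p G" and "group_exponent G \<le> p ^ e"
    and "finite_abelian_p_group p H" and "group_exponent H \<le> p ^ e"
  shows "\<forall>n::int.
     (delta p e G n =
        - alpha p e G + (\<Sum>k=1..e. of_int (rk_tilde p k G) * frac (of_int (n - 1) / real p ^ k)) \<and>
      delta p e (G \<times>\<times> H) n = delta p e G n + delta p e H n) \<and>
     (alpha p e G = (\<Sum>k=1..e. of_int (rk_tilde p k G) * ((real p ^ k - 1) / real p ^ k)) \<and>
      alpha p e (G \<times>\<times> H) = alpha p e G + alpha p e H) \<and>
     (delta p e G 1 = - alpha p e G \<and> - alpha p e G \<le> delta p e G n \<and>
      delta p e G n \<le> 0 \<and> delta p e G 0 = 0)"
proof -
  have G: "comm_group G" "finite (carrier G)" and H: "comm_group H" "finite (carrier H)"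
    using assms by (auto simp: finite_abelian_p_group_def)
  have p: "0 < real p" "1 \<le> real p ^ k" for k
    using prime_gt_0_nat[OF assms(1)] by (auto intro: one_le_power)
  note parts = sum_rk_by_parts[OF assms(1-3)]

  \<comment> \<open>At \<open>k = 0\<close> the argument of \<open>frac\<close> is the integer
    \<open>n - 1\<close>, so \<open>f 0 = 0\<close>.\<close>
  have delta: "delta p e G n =
      - alpha p e G + (\<Sum>k=1..e. of_int (rk_tilde p k G) * frac (of_int (n - 1) / real p ^ k))" for n
    using parts[of "\<lambda>k. frac (of_int (n - 1) / real p ^ k)"]
    by (simp add: delta_def delta_frac_def)

  \<comment> \<open>The weights of \<open>alpha\<close> are the increments of
    \<open>1 - 1 / p ^ k\<close>, which is zero at \<open>k = 0\<close>.\<close>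
  have "(real p - 1) / real p ^ k =
      (real p ^ k - 1) / real p ^ k - (real p ^ (k - 1) - 1) / real p ^ (k - 1)"
    if "k \<in> {1..e}" for k
    using that p(1) by (cases k) (auto simp: field_simps)
  then have "alpha p e G = (\<Sum>k=1..e. real (rk p k G) *
      ((real p ^ k - 1) / real p ^ k - (real p ^ (k - 1) - 1) / real p ^ (k - 1)))"
    unfolding alpha_def by (intro sum.cong) (simp_all add: mult.commute)
  also have "\<dots> = (\<Sum>k=1..e. of_int (rk_tilde p k G) * ((real p ^ k - 1) / real p ^ k))"
    by (rule parts) simp
  finally have alpha:
    "alpha p e G = (\<Sum>k=1..e. of_int (rk_tilde p k G) * ((real p ^ k - 1) / real p ^ k))" .

  have rk: "rk p k (G \<times>\<times> H) = rk p k G + rk p k H" if "k \<in> {1..e}" for k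
    using rk_DirProd[OF assms(1) G H] that by simp
  have alpha_prod: "alpha p e (G \<times>\<times> H) = alpha p e G + alpha p e H"
    by (simp add: alpha_def rk distrib_left sum.distrib)
  have delta_prod: "delta p e (G \<times>\<times> H) n = delta p e G n + delta p e H n" for n
    by (simp add: delta_def alpha_prod rk distrib_right sum.distrib)

  \<comment> \<open>With nonnegative coefficients, both inequalities can be checked term by
    term.\<close>
  have rk_tilde: "0 \<le> real_of_int (rk_tilde p k G)" if "k \<in> {1..e}" for k
    using rk_decreasing[OF assms(1) G] that by (simp add: rk_tilde_def)
  have le: "frac (of_int (n - 1) / real p ^ k) \<le> (real p ^ k - 1) / real p ^ k" for n k
    using frac_of_int_divide_le[of "p ^ k" "n - 1"] prime_gt_0_nat[OF assms(1)] by simp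
  have "delta p e G n \<le> 0" for n
    using sum_mono[OF mult_left_mono[OF le rk_tilde], of "{1..e}" "\<lambda>k. k" "\<lambda>_. n"]
    by (simp add: delta alpha)
  moreover have "- alpha p e G \<le> delta p e G n" for n
    using sum_nonneg[OF mult_nonneg_nonneg[OF rk_tilde frac_ge_0], of "{1..e}" "\<lambda>k. k"
        "\<lambda>k. of_int (n - 1) / real p ^ k"]
    by (simp add: delta)
  moreover have "delta p e G 1 = - alpha p e G"
    by (simp add: delta)
  \<comment> \<open>At \<open>n = 0\<close> every fractional part attains the bound
    \<open>le\<close>, so the sum equals \<open>alpha p e G\<close>.\<close>
  moreover have "delta p e G 0 = 0"
    using frac_minus_one_divide[OF p(2)] by (simp add: delta alpha)
  ultimately show ?thesis
    using delta delta_prod alpha alpha_prod by blast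
qed

end
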